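(* Let $d\in\mathbb{N}$ and, for every $i\in\{1,\dots,d\}$, let $n_i>0$ be a real number, let $h_i:[0,+\infty)\to\mathbb{R}$ be locally Lipschitz continuous and bounded, and let $p_i:\mathbb{R}\to\mathbb{R}$ be continuous and $2\pi$-periodic. Consider the radially coupled system $$x_i''+n_i^2x_i+h_i(|x|)=p_i(t),\qquad i\in\{1,\dots,d\},\qquad x=(x_1,\dots,x_d).\tag{S}$$ Assume that for some $j\in\{1,\dots,d\}$ one has $$n_j\in\mathbb{N}\qquad\text{and}\qquad 2\,\Delta h_j<\left|\int_0^{2\pi}p_j(t)e^{\mathrm{i}n_jt}\,dt\right|.$$ Then, for that $j$, there exist open sets $\mathcal{C}_j^-,\mathcal{C}_j^+\subset\mathbb{R}^2$ such that $\mathbb{R}^2\setminus(\mathcal{C}_j^-\cup\mathcal{C}_j^+)$ is compact, $\mathcal{C}_j^-\cap\mathcal{C}_j^+$ has infinite measure and, moreover, the following holds for every solution $x$ of (S): $$(x_j(0),x_j'(0))\in\mathcal{C}_j^-\ \Longrightarrow\ \lim_{t\to-\infty}\left(x_j(t)^2+x_j'(t)^2\right)=+\infty,$$ $$(x_j(0),x_j'(0))\in\mathcal{C}_j^+\ \Longrightarrow\ \lim_{t\to+\infty}\left(x_j(t)^2+x_j'(t)^2\right)=+\infty.$$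
   Context: $\mathbb{N}=\{1,2,3,\dots\}$; $|x|=\sqrt{x_1^2+\cdots+x_d^2}$ is the Euclidean norm, and $|\cdot|$ applied to a complex number is its modulus. For each $i$, set $$\overline{h}_i(+\infty)=\limsup_{s\to+\infty}h_i(s),\qquad \underline{h}_i(+\infty)=\liminf_{s\to+\infty}h_i(s),\qquad \Delta h_i=\overline{h}_i(+\infty)-\underline{h}_i(+\infty).$$ "Measure" in $\mathbb{R}^2$ is Lebesgue measure. Every solution of the system is defined on all of $\mathbb{R}$. *)

theory Defs
  imports "HOL-Analysis.Analysis"
begin

(* Limsup lives in a complete lattice, hence the detour through ereal; real_of_ereal
   loses nothing here, because these are only used for bounded functions. *)
definition upper_limit_at_top :: "(real \<Rightarrow> real) \<Rightarrow> real" where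
  "upper_limit_at_top f = real_of_ereal (Limsup at_top (\<lambda>s. ereal (f s)))"

definition lower_limit_at_top :: "(real \<Rightarrow> real) \<Rightarrow> real" where
  "lower_limit_at_top f = real_of_ereal (Liminf at_top (\<lambda>s. ereal (f s)))"

definition oscillation_at_top :: "(real \<Rightarrow> real) \<Rightarrow> real" where
  "oscillation_at_top f = upper_limit_at_top f - lower_limit_at_top f"

(* The twice differentiable functions x on the whole real line with
   x_i'' + n_i^2 x_i + h_i(|x|) = p_i(t) for every component i.
   Only the values of h i on the nonnegative half-line matter. *)
definition solves_radial_system ::
  "('d::finite \<Rightarrow> real) \<Rightarrow> ('d \<Rightarrow> real \<Rightarrow> real) \<Rightarrow> ('d \<Rightarrow> real \<Rightarrow> real) \<Rightarrow> (real \<Rightarrow> real ^ 'd) \<Rightarrow> bool" where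
  "solves_radial_system n h p x \<longleftrightarrow>
     (\<forall>i t. (\<lambda>s. x s $ i) differentiable (at t) \<and>
            deriv (\<lambda>s. x s $ i) differentiable (at t) \<and>
            deriv (deriv (\<lambda>s. x s $ i)) t + (n i)\<^sup>2 * x t $ i + h i (norm (x t)) = p i t)"

end

theory Submission
  imports Defs
begin

text \<open>Only the \<open>j\<close>-th component matters. Write \<open>y\<close> for it, \<open>v = y'\<close>, \<open>N = n j\<close>, \<open>p = p j\<close> and
\<open>g t = h j (norm (x t))\<close>, so that \<open>y'' + N\<^sup>2 y = p - g\<close> with a bounded right-hand side. The other
components enter through \<open>g\<close> alone, and about \<open>g\<close> two things are known: it is bounded, and, because
\<open>norm (x t) \<ge> \<bar>y t\<bar>\<close>, it stays within a band of half-width about \<open>\<Delta>h/2\<close> whenever \<open>\<bar>y t\<bar>\<close> is large.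

In the frame rotating with the free oscillator, the state \<open>u = exp (-\<i>Nt) (v + \<i>Ny)\<close> satisfies
\<open>u' = (p - g) exp (-\<i>Nt)\<close>. Over a period the forcing moves \<open>u\<close> by the constant vector
\<open>P = \<integral> p exp (-\<i>Nt)\<close>, whereas the component of the coupling term along \<open>e = sgn P\<close> is an integral
\<open>\<integral> g cos (Nt + \<phi>)\<close>. The centre of the band integrates to \<open>0\<close> and \<open>\<integral> \<bar>cos\<bar> = 4\<close>, so this is at most
about \<open>4 \<cdot> \<Delta>h/2 = 2 \<Delta>h\<close>, provided that the times at which \<open>\<bar>y\<bar>\<close> is small can be neglected. They can when
\<open>\<bar>u\<bar>\<close> is large, since then \<open>y\<close> is close to a sinusoid of large amplitude. As \<open>2 \<Delta>h < \<bar>P\<bar>\<close>, the component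
of \<open>u\<close> along \<open>e\<close> gains a fixed amount \<open>\<delta> > 0\<close> over every period that starts with \<open>\<bar>u\<bar>\<close> large
(\<open>resonant_gain_over_period\<close>).

The functional \<open>\<bar>u\<bar> + \<kappa> (component of u along e)\<close> turns this into escape: \<open>\<bar>u\<bar>\<close> loses at most a fixed
amount per period, so for \<open>\<kappa>\<close> large the functional increases by at least \<open>1\<close>, and a large value of it
forces \<open>\<bar>u\<bar>\<close> to be large, which keeps the argument going (\<open>norm_at_top_if_escaping\<close>). Hence \<open>C_plus\<close> can be taken as
a superlevel set of this functional, and \<open>C_minus\<close> as the same set for \<open>-e\<close>, since reversing time reverses
the drift. Outside both sets \<open>\<bar>u\<bar> + \<kappa> \<bar>component\<bar>\<close> is bounded, which gives compactness, while their intersection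
is open, contains points with large \<open>u\<close> orthogonal to \<open>e\<close>, and is stable under doubling, which gives infinite measure.\<close>

section \<open>Integrals of periodic functions\<close>

text \<open>An antiderivative \<open>G\<close> of \<open>F\<close> increases by a constant over every period, and \<open>G (N t + \<theta>) / N\<close> is an
antiderivative of the integrand that runs through \<open>N\<close> periods; the phase and the starting time drop out.\<close>

lemma has_integral_periodic:
  fixes F :: "real \<Rightarrow> 'a::euclidean_space"
  assumes cont: "continuous_on UNIV F" and per: "\<And>s. F (s + 2 * pi) = F s" and N: "N \<ge> (1::nat)"
  shows "((\<lambda>t. F (real N * t + \<theta>)) has_integral integral {0..2 * pi} F) {T..T + 2 * pi}"
proof -
  obtain G where G: "\<And>s. (G has_vector_derivative F s) (at s)"
    using einterval_antiderivative[of "-\<infinity>" "\<infinity>" F] cont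
    by (auto simp: continuous_on_eq_continuous_at)
  have "((\<lambda>s. G (s + 2 * pi) - G s) has_vector_derivative 0) (at s)" for s
  proof -
    have "((\<lambda>s. G (s + 2 * pi)) has_vector_derivative 1 *\<^sub>R F (s + 2 * pi)) (at s)"
      using G by (intro vector_diff_chain_at[of "\<lambda>s. s + 2 * pi" 1 s G, unfolded o_def])
        (auto intro!: derivative_eq_intros)
    from has_vector_derivative_diff[OF this G[of s]] show ?thesis
      by (simp add: per)
  qed
  then obtain c where c: "\<And>s. G (s + 2 * pi) - G s = c"
    using has_vector_derivative_zero_constant[of UNIV "\<lambda>s. G (s + 2 * pi) - G s"] by auto
  have multi: "G (s + real k * (2 * pi)) - G s = real k *\<^sub>R c" for s k
  proof (induction k)
    case (Suc k)
    have "G (s + real (Suc k) * (2 * pi)) = G (s + real k * (2 * pi)) + c"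
      using c[of "s + real k * (2 * pi)"] by (simp add: algebra_simps)
    then show ?case using Suc by (simp add: algebra_simps)
  qed auto
  have "(F has_integral G (2 * pi) - G 0) {0..2 * pi}"
    by (rule fundamental_theorem_of_calculus) (auto intro: has_vector_derivative_at_within G)
  then have int: "integral {0..2 * pi} F = c"
    using c[of 0] by (simp add: integral_unique)
  define H where "H t = (1 / real N) *\<^sub>R G (real N * t + \<theta>)" for t
  have "(H has_vector_derivative F (real N * t + \<theta>)) (at t)" for t
  proof -
    have "((\<lambda>t. G (real N * t + \<theta>)) has_vector_derivative real N *\<^sub>R F (real N * t + \<theta>)) (at t)"
      using G by (intro vector_diff_chain_at[of "\<lambda>t. real N * t + \<theta>" "real N" t G, unfolded o_def])
        (auto intro!: derivative_eq_intros)
    from bounded_linear.has_vector_derivative[OF bounded_linear_scaleR_right[of "1 / real N"] this]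
    show ?thesis using N unfolding H_def by simp
  qed
  then have "((\<lambda>t. F (real N * t + \<theta>)) has_integral H (T + 2 * pi) - H T) {T..T + 2 * pi}"
    by (intro fundamental_theorem_of_calculus) (auto intro: has_vector_derivative_at_within)
  moreover have "H (T + 2 * pi) - H T = c"
    using multi[of "real N * T + \<theta>" N] N
    by (simp add: H_def algebra_simps flip: scaleR_diff_right)
  ultimately show ?thesis by (simp add: int)
qed

lemma integral_cos_period: "integral {0..2 * pi} cos = 0"
proof -
  have "(cos has_integral sin (2 * pi) - sin 0) {0..2 * pi}"
    by (rule fundamental_theorem_of_calculus)
      (auto intro!: derivative_eq_intros simp flip: has_real_derivative_iff_has_vector_derivative)
  then show ?thesis by (simp add: integral_unique)
qed

lemma integral_abs_cos_period: "integral {0..2 * pi} (\<lambda>s. \<bar>cos s\<bar>) = 4"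
proof -
  have piece: "((\<lambda>s. \<bar>cos s\<bar>) has_integral 2) {a..a + pi}"
    if sgn: "\<And>s. s \<in> {a..a + pi} \<Longrightarrow> \<bar>cos s\<bar> = \<sigma> * cos s" and sin: "\<sigma> * sin a = - 1" for a \<sigma>
  proof -
    have "((\<lambda>s. \<sigma> * cos s) has_integral \<sigma> * sin (a + pi) - \<sigma> * sin a) {a..a + pi}"
      by (rule fundamental_theorem_of_calculus)
        (auto intro!: derivative_eq_intros simp flip: has_real_derivative_iff_has_vector_derivative)
    then have "((\<lambda>s. \<sigma> * cos s) has_integral 2) {a..a + pi}"
      using sin by simp
    then show ?thesis
      by (rule has_integral_eq[rotated]) (use sgn in auto)
  qed
  have 1: "((\<lambda>s. \<bar>cos s\<bar>) has_integral 2) {- (pi / 2)..- (pi / 2) + pi}"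
    by (rule piece[of _ 1]) (auto intro!: cos_ge_zero abs_of_nonneg)
  have 2: "((\<lambda>s. \<bar>cos s\<bar>) has_integral 2) {pi / 2..pi / 2 + pi}"
  proof (rule piece[of _ "-1"])
    fix s assume "s \<in> {pi / 2..pi / 2 + pi}"
    then have "cos (s - pi) \<ge> 0" by (intro cos_ge_zero) auto
    then show "\<bar>cos s\<bar> = - 1 * cos s" by simp
  qed auto
  have "((\<lambda>s. \<bar>cos s\<bar>) has_integral 2 + 2) {- (pi / 2)..pi / 2 + pi}"
    by (rule has_integral_combine[of _ "pi / 2"]) (use 1 2 in auto)
  moreover have "((\<lambda>s. \<bar>cos (real 1 * s + 0)\<bar>) has_integral integral {0..2 * pi} (\<lambda>s. \<bar>cos s\<bar>)) {- (pi / 2)..- (pi / 2) + 2 * pi}"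
    by (rule has_integral_periodic[of "\<lambda>s. \<bar>cos s\<bar>"]) (auto intro!: continuous_intros)
  ultimately show ?thesis
    by (simp add: has_integral_unique algebra_simps)
qed

lemma integral_cos_power_tendsto_0:
  "(\<lambda>k. integral {0..2 * pi} (\<lambda>s. (cos s)\<^sup>2 ^ k)) \<longlonglongrightarrow> 0"
proof -
  let ?Z = "{s. sin s = (0::real)}"
  have Z: "negligible ?Z"
  proof -
    have "?Z \<subseteq> range (\<lambda>i. of_int i * pi)" by (auto simp: sin_zero_iff_int2)
    then have "countable ?Z" by (rule countable_subset) auto
    then show ?thesis
      by (simp add: negligible_iff_null_sets countable_imp_null_set_lborel null_sets_completionI)
  qed
  have "(\<lambda>k. integral {0..2 * pi} (\<lambda>s. (cos s)\<^sup>2 ^ k)) \<longlonglongrightarrow> integral {0..2 * pi} (indicat_real ?Z)"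
  proof (rule dominated_convergence(2)[where h = "\<lambda>_. 1"])
    show "(\<lambda>s. (cos s)\<^sup>2 ^ k) integrable_on {0..2 * pi}" for k :: nat
      by (intro integrable_continuous_real continuous_intros)
    show "norm ((cos s)\<^sup>2 ^ k) \<le> 1" for s :: real and k :: nat
      by (simp add: power_le_one abs_square_le_1)
    show "(\<lambda>k. (cos s)\<^sup>2 ^ k) \<longlonglongrightarrow> indicat_real ?Z s" for s :: real
    proof (cases "sin s = 0")
      case True
      then show ?thesis by (simp add: cos_squared_eq)
    next
      case False
      then have "(cos s)\<^sup>2 < 1" by (simp add: cos_squared_eq)
      then show ?thesis using False by (simp add: LIMSEQ_realpow_zero)
    qed
  qed auto
  moreover have "integral {0..2 * pi} (indicat_real ?Z) = 0"
    using Z by (auto simp: negligible_def intro!: integral_unique)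
  ultimately show ?thesis by simp
qed

text \<open>A continuous periodic substitute for the indicator function of the times at which \<open>sin\<close> is small: the
powers of \<open>cos\<^sup>2\<close> converge to \<open>0\<close> away from the zeros of \<open>sin\<close>, so a high power has a small integral but is
still at least \<open>1/2\<close> close to those zeros.\<close>

lemma bump_near_sine_zeros:
  assumes "\<epsilon> > 0"
  obtains \<eta> :: real and \<beta> :: "real \<Rightarrow> real"
  where "\<eta> > 0" "continuous_on UNIV \<beta>" "\<And>s. \<beta> (s + 2 * pi) = \<beta> s" "\<And>s. \<beta> s \<ge> 0"
    "\<And>s. \<bar>sin s\<bar> \<le> \<eta> \<Longrightarrow> \<beta> s \<ge> 1" "integral {0..2 * pi} \<beta> \<le> \<epsilon>"
proof -
  have "\<forall>\<^sub>F k in sequentially. integral {0..2 * pi} (\<lambda>s. (cos s)\<^sup>2 ^ k) < \<epsilon> / 2"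
    using order_tendstoD(2)[OF integral_cos_power_tendsto_0, of "\<epsilon> / 2"] assms by simp
  then obtain k where k: "integral {0..2 * pi} (\<lambda>s. (cos s)\<^sup>2 ^ k) < \<epsilon> / 2"
    by (auto simp: eventually_sequentially)
  have "(\<lambda>\<eta>::real. (1 - \<eta>\<^sup>2) ^ k) \<midarrow>0\<rightarrow> (1 - 0\<^sup>2) ^ k"
    by (intro tendsto_intros)
  then have "\<forall>\<^sub>F \<eta>::real in at_right 0. (1 - \<eta>\<^sup>2) ^ k > 1 / 2"
    by (intro order_tendstoD(1)) (auto intro: filterlim_mono at_le)
  then have "\<forall>\<^sub>F \<eta>::real in at_right 0. (1 - \<eta>\<^sup>2) ^ k > 1 / 2 \<and> \<eta> \<in> {0<..<1}"
    by (intro eventually_conj eventually_at_right_real) auto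
  then obtain \<eta> :: real where \<eta>: "(1 - \<eta>\<^sup>2) ^ k > 1 / 2" "0 < \<eta>" "\<eta> < 1"
    by (auto dest!: eventually_happens)
  show ?thesis
  proof (rule that[of \<eta> "\<lambda>s. 2 * (cos s)\<^sup>2 ^ k"])
    fix s :: real assume "\<bar>sin s\<bar> \<le> \<eta>"
    then have "(sin s)\<^sup>2 \<le> \<eta>\<^sup>2" using power_mono[of "\<bar>sin s\<bar>" \<eta> 2] by simp
    then have "1 - \<eta>\<^sup>2 \<le> (cos s)\<^sup>2" by (simp add: cos_squared_eq)
    then have "(1 - \<eta>\<^sup>2) ^ k \<le> (cos s)\<^sup>2 ^ k"
      using \<eta> by (intro power_mono) (auto simp: power_le_one)
    then show "1 \<le> 2 * (cos s)\<^sup>2 ^ k" using \<eta> by simp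
  qed (use \<eta> k in \<open>auto intro!: continuous_intros\<close>)
qed

section \<open>Measure of sets stable under doubling\<close>

text \<open>Doubling multiplies the measure by \<open>2 ^ DIM('a) \<ge> 2\<close> but stays inside \<open>S\<close>, so a finite measure would be \<open>0\<close>,
and nonempty open sets are not negligible.\<close>

lemma emeasure_scaling_invariant_open:
  fixes S :: "'a::euclidean_space set"
  assumes "open S" "S \<noteq> {}" and scale: "\<And>z. z \<in> S \<Longrightarrow> 2 *\<^sub>R z \<in> S"
  shows "emeasure lebesgue S = \<infinity>"
proof (rule ccontr)
  assume fin: "emeasure lebesgue S \<noteq> \<infinity>"
  have S: "S \<in> lmeasurable"
    using fin assms(1) by (intro fmeasurableI) (auto simp: top.not_eq_extremum)
  have eq: "measure lebesgue ((\<lambda>x. 2 *\<^sub>R x + 0) ` S) = \<bar>2\<bar> ^ DIM('a) * measure lebesgue S"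
    by (rule measure_lebesgue_affine)
  have sub: "(\<lambda>x. 2 *\<^sub>R x + 0) ` S \<subseteq> S" using scale by auto
  have "open ((\<lambda>x. 2 *\<^sub>R x) ` S)" using assms(1) by (intro open_scaling) auto
  then have "measure lebesgue ((\<lambda>x. 2 *\<^sub>R x + 0) ` S) \<le> measure lebesgue S"
    using S sub by (intro measure_mono_fmeasurable) auto
  moreover have "(2::real) \<le> 2 ^ DIM('a)"
    using power_increasing[of 1 "DIM('a)" "2::real"] by simp
  moreover have "measure lebesgue S > 0"
  proof -
    have "\<not> negligible S" using assms open_not_negligible by blast
    then show ?thesis using S by (simp add: negligible_iff_measure0 less_le)
  qed
  ultimately show False
    unfolding eq by (simp add: not_le[symmetric])
qed

section \<open>Drift of the resonant oscillator\<close>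

text \<open>The phase point of the oscillator \<open>y'' + N\<^sup>2 y = 0\<close>, seen in the frame that rotates with the free motion:
without forcing it is constant in time.\<close>

definition rotating_state :: "nat \<Rightarrow> (real \<Rightarrow> real) \<Rightarrow> (real \<Rightarrow> real) \<Rightarrow> real \<Rightarrow> complex" where
  "rotating_state N y v t = cis (- (real N * t)) * Complex (v t) (real N * y t)"

lemma rotating_state_has_vector_derivative:
  assumes y: "(y has_real_derivative v t) (at t)"
    and v: "(v has_real_derivative f - (real N)\<^sup>2 * y t) (at t)"
  shows "(rotating_state N y v has_vector_derivative f *\<^sub>R cis (- (real N * t))) (at t)"
proof -
  have Re: "((\<lambda>t. Re (rotating_state N y v t)) has_real_derivative Re (f *\<^sub>R cis (- (real N * t)))) (at t)"
    unfolding rotating_state_def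
    by (auto intro!: derivative_eq_intros y v simp: algebra_simps power2_eq_square)
  have Im: "((\<lambda>t. Im (rotating_state N y v t)) has_real_derivative Im (f *\<^sub>R cis (- (real N * t)))) (at t)"
    unfolding rotating_state_def
    by (auto intro!: derivative_eq_intros y v simp: algebra_simps power2_eq_square)
  show ?thesis
    using Re Im by (simp add: has_vector_derivative_complex_iff has_real_derivative_iff_has_vector_derivative)
qed

lemma rotating_state_lipschitz:
  assumes y: "\<And>t. (y has_real_derivative v t) (at t)"
    and v: "\<And>t. (v has_real_derivative f t - (real N)\<^sup>2 * y t) (at t)"
    and M: "\<And>t. \<bar>f t\<bar> \<le> M"
  shows "norm (rotating_state N y v t - rotating_state N y v s) \<le> M * \<bar>t - s\<bar>"
proof -
  have "norm (rotating_state N y v t - rotating_state N y v s) \<le> M * norm (t - s)"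
  proof (rule differentiable_bound[of UNIV _ "\<lambda>t x. x *\<^sub>R (f t *\<^sub>R cis (- (real N * t)))"])
    show "onorm (\<lambda>x. x *\<^sub>R (f s *\<^sub>R cis (- (real N * s)))) \<le> M" for s
      by (rule onorm_le) (simp add: abs_mult mult.commute[of M] mult_left_mono[OF M])
  qed (use rotating_state_has_vector_derivative[OF y v] in \<open>auto simp: has_vector_derivative_def\<close>)
  then show ?thesis by simp
qed

lemma cmod_rotating_state: "(norm (rotating_state N y v t))\<^sup>2 = (v t)\<^sup>2 + (real N * y t)\<^sup>2"
  by (simp add: rotating_state_def norm_mult cmod_power2)

text \<open>The gain is the projection of \<open>\<integral> (p - g) cis (-Nt)\<close> onto \<open>e = cis \<phi>\<close>, that is, the contribution of \<open>p\<close> minus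
\<open>\<integral> (g - c) cos (Nt + \<phi>)\<close>; the constant \<open>c\<close> may be subtracted because \<open>cos\<close> has mean \<open>0\<close>. Where \<open>\<bar>y\<bar> \<ge> R\<close> the
last integrand is at most \<open>\<rho> \<bar>cos\<bar>\<close>, with integral \<open>4 \<rho>\<close>. Where \<open>\<bar>y\<bar> < R\<close> it is at most \<open>B\<close>; as \<open>u\<close> hardly moves
compared with its size, \<open>N y\<close> is then close to \<open>\<bar>u T\<bar> sin (Nt + \<theta>)\<close>, so this sine is small and the bump \<open>b\<close> is
at least \<open>1\<close>.\<close>

lemma resonant_gain_over_period:
  fixes y v p g :: "real \<Rightarrow> real" and N :: nat
  defines "u \<equiv> rotating_state N y v"
  assumes N: "N \<ge> 1"
    and y: "\<And>t. (y has_real_derivative v t) (at t)"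
    and v: "\<And>t. (v has_real_derivative p t - g t - (real N)\<^sup>2 * y t) (at t)"
    and p_cont: "continuous_on UNIV p" and p_per: "\<And>t. p (t + 2 * pi) = p t"
    and M: "\<And>t. \<bar>p t - g t\<bar> \<le> M"
    and \<rho>: "\<rho> \<ge> 0" and close: "\<And>t. \<bar>y t\<bar> \<ge> R \<Longrightarrow> \<bar>g t - c\<bar> \<le> \<rho>"
    and B: "\<And>t. \<bar>g t - c\<bar> \<le> B"
    and b_cont: "continuous_on UNIV b" and b_per: "\<And>s. b (s + 2 * pi) = b s"
    and b_nonneg: "\<And>s. b s \<ge> 0" and b_sin: "\<And>s. \<bar>sin s\<bar> \<le> \<eta> \<Longrightarrow> b s \<ge> 1"
    and large: "norm (u T) * \<eta> \<ge> real N * R + 2 * pi * M"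
    and e: "norm e = 1"
  shows "Re (cnj e * (u (T + 2 * pi) - u T)) \<ge>
    Re (cnj e * integral {0..2 * pi} (\<lambda>t. p t *\<^sub>R cis (- (real N * t)))) - 4 * \<rho> - B * integral {0..2 * pi} b"
proof -
  let ?P = "integral {0..2 * pi} (\<lambda>t. p t *\<^sub>R cis (- (real N * t)))"
  let ?I = "{T..T + 2 * pi}"
  have u': "(u has_vector_derivative (p t - g t) *\<^sub>R cis (- (real N * t))) (at t)" for t
    unfolding u_def by (rule rotating_state_has_vector_derivative[OF y v])
  obtain \<phi> where \<phi>: "e = cis \<phi>"
    using e rcis_cmod_Arg[of e] by (metis mult_1 of_real_1 rcis_def)
  have proj: "Re (cnj e * (q *\<^sub>R cis (- (real N * t)))) = q * cos (real N * t + \<phi>)" for q t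
    by (simp add: \<phi> cos_add algebra_simps)
  have blin: "bounded_linear (\<lambda>z. Re (cnj e * z))"
    by (intro bounded_linear_compose[OF bounded_linear_Re bounded_linear_mult_right])
  have total: "((\<lambda>t. (p t - g t) * cos (real N * t + \<phi>)) has_integral Re (cnj e * (u (T + 2 * pi) - u T))) ?I"
  proof -
    have "((\<lambda>t. (p t - g t) *\<^sub>R cis (- (real N * t))) has_integral u (T + 2 * pi) - u T) ?I"
      by (rule fundamental_theorem_of_calculus) (auto intro: has_vector_derivative_at_within u')
    from has_integral_linear[OF this blin] show ?thesis by (simp only: o_def proj)
  qed
  have forcing: "((\<lambda>t. p t * cos (real N * t + \<phi>)) has_integral Re (cnj e * ?P)) ?I"
  proof -
    have "cis (- (real N * (t + 2 * pi))) = cis (- (real N * t))" for t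
    proof -
      have "cis (- (real N * (t + 2 * pi))) = cis (- (real N * t)) * cis (2 * pi * real_of_int (- int N))"
        by (simp add: cis_mult algebra_simps)
      then show ?thesis by (subst (asm) cis_multiple_2pi) auto
    qed
    then have "((\<lambda>t. p (real 1 * t + 0) *\<^sub>R cis (- (real N * (real 1 * t + 0)))) has_integral ?P) ?I"
      by (intro has_integral_periodic[of "\<lambda>t. p t *\<^sub>R cis (- (real N * t))"])
        (auto intro!: continuous_intros p_cont simp: p_per)
    then have "((\<lambda>t. p t *\<^sub>R cis (- (real N * t))) has_integral ?P) ?I" by simp
    from has_integral_linear[OF this blin] show ?thesis by (simp only: o_def proj)
  qed
  have centre: "((\<lambda>t. c * cos (real N * t + \<phi>)) has_integral c * 0) ?I"
    using has_integral_periodic[of cos N \<phi> T] N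
    by (intro has_integral_mult_right) (simp add: integral_cos_period continuous_on_cos)
  have coupling: "((\<lambda>t. (g t - c) * cos (real N * t + \<phi>)) has_integral
      Re (cnj e * ?P) - Re (cnj e * (u (T + 2 * pi) - u T))) ?I"
    using has_integral_diff[OF has_integral_diff[OF forcing total] centre]
    by (simp add: algebra_simps)

  \<comment> \<open>The polar form of \<open>u T\<close> gives the sinusoid that \<open>N y\<close> follows during the period.\<close>
  obtain r \<theta> where r: "u T = rcis r \<theta>" "r \<ge> 0"
    by (metis norm_ge_zero rcis_cmod_Arg)
  have rarely_small: "b (real N * t + \<theta>) \<ge> 1" if t: "t \<in> ?I" and small: "\<bar>y t\<bar> < R" for t
  proof (rule b_sin)
    have "norm (u t - u T) \<le> M * \<bar>t - T\<bar>"
      unfolding u_def by (rule rotating_state_lipschitz[OF y v M])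
    moreover have "M \<ge> 0" using M[of 0] by linarith
    ultimately have drift: "norm (u T - u t) \<le> 2 * pi * M"
      using t mult_left_mono[of "t - T" "2 * pi" M] by (auto simp: norm_minus_commute mult.commute)
    have y_eq: "real N * y t = Im (cis (real N * t) * u t)"
      unfolding u_def rotating_state_def mult.assoc[symmetric] cis_mult by simp
    have split: "cis (real N * t) * u T = cis (real N * t) * u t + cis (real N * t) * (u T - u t)"
      by (simp only: distrib_left[symmetric] add_diff_cancel_left' diff_add_cancel add_diff_eq)
    have "r * sin (real N * t + \<theta>) = Im (cis (real N * t) * u T)"
      unfolding r(1) rcis_def by (simp add: sin_add algebra_simps)
    also have "\<dots> = real N * y t + Im (cis (real N * t) * (u T - u t))"
      unfolding split y_eq by (rule plus_complex.sel(2))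
    finally have "\<bar>r * sin (real N * t + \<theta>)\<bar> \<le>
        \<bar>real N * y t\<bar> + \<bar>Im (cis (real N * t) * (u T - u t))\<bar>"
      by (simp only: abs_triangle_ineq)
    also have "\<dots> \<le> real N * \<bar>y t\<bar> + norm (u T - u t)"
      using abs_Im_le_cmod[of "cis (real N * t) * (u T - u t)"]
      by (simp only: norm_mult norm_cis mult_1 abs_mult abs_of_nat add_left_mono)
    also have "\<dots> < real N * R + 2 * pi * M"
      using small drift N by (intro add_less_le_mono mult_strict_left_mono) auto
    also have "\<dots> \<le> r * \<eta>" using large r by simp
    finally have "r * \<bar>sin (real N * t + \<theta>)\<bar> < r * \<eta>" using r by (simp add: abs_mult)
    then show "\<bar>sin (real N * t + \<theta>)\<bar> \<le> \<eta>"
      using r(2) by (simp add: mult_less_cancel_left)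
  qed
  have "B \<ge> 0" using B[of 0] by linarith
  have majorant: "((\<lambda>t. \<rho> * \<bar>cos (real N * t + \<phi>)\<bar> + B * b (real N * t + \<theta>)) has_integral
      \<rho> * 4 + B * integral {0..2 * pi} b) ?I"
    using has_integral_periodic[of "\<lambda>s. \<bar>cos s\<bar>" N \<phi> T, OF continuous_on_rabs[OF continuous_on_cos[OF continuous_on_id]]]
      has_integral_periodic[of b N \<theta> T, OF b_cont b_per N] N
    by (intro has_integral_add has_integral_mult_right)
      (auto simp: integral_abs_cos_period)
  have "Re (cnj e * ?P) - Re (cnj e * (u (T + 2 * pi) - u T)) \<le> \<rho> * 4 + B * integral {0..2 * pi} b"
  proof (rule has_integral_le[OF coupling majorant])
    fix t assume t: "t \<in> ?I"
    have "(g t - c) * cos (real N * t + \<phi>) \<le> \<bar>g t - c\<bar> * \<bar>cos (real N * t + \<phi>)\<bar>"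
      by (metis abs_ge_self abs_mult)
    also have "\<dots> \<le> \<rho> * \<bar>cos (real N * t + \<phi>)\<bar> + B * b (real N * t + \<theta>)"
    proof (cases "\<bar>y t\<bar> < R")
      case True
      have "\<bar>g t - c\<bar> * \<bar>cos (real N * t + \<phi>)\<bar> \<le> B * b (real N * t + \<theta>)"
        using B[of t] rarely_small[OF t True] abs_cos_le_one[of "real N * t + \<phi>"] \<open>B \<ge> 0\<close>
        by (intro mult_mono) linarith+
      moreover have "\<rho> * \<bar>cos (real N * t + \<phi>)\<bar> \<ge> 0" using \<rho> by simp
      ultimately show ?thesis by linarith
    next
      case False
      then have "\<bar>g t - c\<bar> * \<bar>cos (real N * t + \<phi>)\<bar> \<le> \<rho> * \<bar>cos (real N * t + \<phi>)\<bar>"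
        using close[of t] by (intro mult_right_mono) auto
      then show ?thesis using \<open>B \<ge> 0\<close> b_nonneg by (simp add: add_increasing2)
    qed
    finally show "(g t - c) * cos (real N * t + \<phi>) \<le> \<rho> * \<bar>cos (real N * t + \<phi>)\<bar> + B * b (real N * t + \<theta>)" .
  qed
  then show ?thesis by simp
qed

section \<open>Escape to infinity by a drift in one direction\<close>

definition escape_functional :: "real \<Rightarrow> complex \<Rightarrow> complex \<Rightarrow> real" where
  "escape_functional \<kappa> e z = norm z + \<kappa> * Re (cnj e * z)"

text \<open>While the functional exceeds \<open>(1 + \<kappa>) R\<close>, the norm exceeds \<open>R\<close>. So the component along \<open>e\<close> gains \<open>\<delta>\<close> in the next
period, which \<open>\<kappa>\<close> weights so heavily that it outweighs by \<open>1\<close> the largest possible loss \<open>2 pi M\<close> of norm.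
The functional thus tends to infinity along the multiples of the period, and it is at most \<open>(1 + \<kappa>)\<close> times the norm.\<close>

lemma norm_at_top_if_escaping:
  fixes u :: "real \<Rightarrow> complex"
  assumes lip: "\<And>s t. norm (u t - u s) \<le> M * \<bar>t - s\<bar>"
    and gain: "\<And>k::nat. norm (u (2 * pi * k)) \<ge> R \<Longrightarrow>
      Re (cnj e * (u (2 * pi * real (Suc k)) - u (2 * pi * k))) \<ge> \<delta>"
    and e: "norm e = 1" and \<kappa>: "\<kappa> \<ge> 0" "\<kappa> * \<delta> \<ge> 2 * pi * M + 1"
    and start: "escape_functional \<kappa> e (u 0) > (1 + \<kappa>) * R"
  shows "filterlim (\<lambda>t. norm (u t)) at_top at_top"
proof -
  have le: "escape_functional \<kappa> e z \<le> (1 + \<kappa>) * norm z" for z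
  proof -
    have "Re (cnj e * z) \<le> norm z" using complex_Re_le_cmod[of "cnj e * z"] e by (simp add: norm_mult)
    from mult_left_mono[OF this \<kappa>(1)] show ?thesis
      unfolding escape_functional_def by (simp add: distrib_right del: times_complex.sel)
  qed
  have grow: "escape_functional \<kappa> e (u (2 * pi * k)) > (1 + \<kappa>) * R + k" for k :: nat
  proof (induction k)
    case 0
    then show ?case using start by simp
  next
    case (Suc k)
    let ?a = "u (2 * pi * k)" and ?b = "u (2 * pi * real (Suc k))"
    have "(1 + \<kappa>) * R < (1 + \<kappa>) * norm ?a" using Suc le[of ?a] by (simp add: add.commute)
    then have "norm ?a \<ge> R" using \<kappa>(1) by (simp add: mult_less_cancel_left)
    then have "Re (cnj e * (?b - ?a)) \<ge> \<delta>" by (rule gain)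
    then have "\<kappa> * Re (cnj e * (?b - ?a)) \<ge> 2 * pi * M + 1"
      using \<kappa> mult_left_mono by (meson order_trans)
    moreover have "norm ?b \<ge> norm ?a - 2 * pi * M"
    proof -
      have "norm (?b - ?a) \<le> M * \<bar>2 * pi * real (Suc k) - 2 * pi * k\<bar>" by (rule lip)
      then have "norm (?b - ?a) \<le> 2 * pi * M" by (simp add: algebra_simps)
      then show ?thesis using norm_triangle_ineq2[of ?a ?b] by (simp add: norm_minus_commute)
    qed
    ultimately have "escape_functional \<kappa> e ?b \<ge> escape_functional \<kappa> e ?a + 1"
      by (simp add: escape_functional_def algebra_simps)
    then show ?case using Suc by (simp add: add.commute)
  qed
  have M: "M \<ge> 0" using lip[of 1 0] norm_ge_zero[of "u 1 - u 0"] by (simp del: norm_ge_zero)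
  have lower: "norm (u t) \<ge> R + (t / (2 * pi) - 1) / (1 + \<kappa>) - 2 * pi * M" if "t \<ge> 0" for t
  proof -
    define k where "k = nat \<lfloor>t / (2 * pi)\<rfloor>"
    have k: "real k \<le> t / (2 * pi)" "t / (2 * pi) < real k + 1"
      using that by (auto simp: k_def)
    have "0 \<le> t - 2 * pi * k" "t - 2 * pi * k \<le> 2 * pi"
      using k by (auto simp: field_simps)
    then have "norm (u t - u (2 * pi * k)) \<le> M * (2 * pi)"
      by (intro order_trans[OF lip] mult_left_mono M) auto
    then have 1: "norm (u t) \<ge> norm (u (2 * pi * k)) - 2 * pi * M"
      using norm_triangle_ineq2[of "u (2 * pi * k)" "u t"] by (simp add: norm_minus_commute mult.commute)
    have "(1 + \<kappa>) * R + real k \<le> (1 + \<kappa>) * norm (u (2 * pi * k))"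
      using grow[of k] le[of "u (2 * pi * k)"] by simp
    then have "(1 + \<kappa>) * (R + (t / (2 * pi) - 1) / (1 + \<kappa>)) \<le> (1 + \<kappa>) * norm (u (2 * pi * k))"
      using k \<kappa>(1) by (simp add: distrib_left)
    then have "R + (t / (2 * pi) - 1) / (1 + \<kappa>) \<le> norm (u (2 * pi * k))"
      using \<kappa>(1) by (simp add: mult_le_cancel_left)
    then show ?thesis using 1 by simp
  qed
  show ?thesis
  proof (rule filterlim_at_top_mono)
    have "LIM t at_top. (R - 1 / (1 + \<kappa>) - 2 * pi * M) + 1 / (2 * pi * (1 + \<kappa>)) * t :> at_top"
      using \<kappa>(1)
      by (intro filterlim_tendsto_add_at_top[OF tendsto_const]
          filterlim_tendsto_pos_mult_at_top[OF tendsto_const] filterlim_ident) simp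
    then show "LIM t at_top. R + (t / (2 * pi) - 1) / (1 + \<kappa>) - 2 * pi * M :> at_top"
      by (simp add: diff_divide_distrib algebra_simps)
    show "\<forall>\<^sub>F t in at_top. R + (t / (2 * pi) - 1) / (1 + \<kappa>) - 2 * pi * M \<le> norm (u t)"
      using eventually_ge_at_top[of 0] by eventually_elim (rule lower)
  qed
qed

section \<open>The regions of escaping initial data\<close>

text \<open>Initial data \<open>(a, b) = (y 0, v 0)\<close> correspond to the rotating state \<open>b + \<i> N a\<close> at time \<open>0\<close>.\<close>

definition escape_region :: "nat \<Rightarrow> real \<Rightarrow> real \<Rightarrow> complex \<Rightarrow> (real \<times> real) set" where
  "escape_region N L \<kappa> e = {(a, b). escape_functional \<kappa> e (Complex b (real N * a)) > L}"

lemma open_escape_region: "open (escape_region N L \<kappa> e)"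
  unfolding escape_region_def escape_functional_def case_prod_unfold complex_eq cmod_def
  by (intro open_Collect_less continuous_intros)

text \<open>One of the two functionals adds a nonnegative term to the norm, so outside both regions the norm is at most \<open>L\<close>.\<close>

lemma compact_complement_escape_regions:
  assumes N: "N \<ge> 1" and \<kappa>: "\<kappa> \<ge> 0"
  shows "compact (UNIV - (escape_region N L \<kappa> (- e) \<union> escape_region N L \<kappa> e))"
proof -
  have "UNIV - (escape_region N L \<kappa> (- e) \<union> escape_region N L \<kappa> e) \<subseteq> {- L..L} \<times> {- L..L}"
  proof (clarsimp simp only: subset_iff mem_Times_iff split_paired_all Diff_iff Un_iff de_Morgan_disj fst_conv snd_conv atLeastAtMost_iff)
    fix a b assume *: "(a, b) \<notin> escape_region N L \<kappa> (- e)" "(a, b) \<notin> escape_region N L \<kappa> e"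
    let ?z = "Complex b (real N * a)"
    have "norm ?z \<le> L"
    proof (cases "Re (cnj e * ?z) \<ge> 0")
      case True
      then have "\<kappa> * Re (cnj e * ?z) \<ge> 0" using \<kappa> by simp
      then show ?thesis using * by (simp add: escape_region_def escape_functional_def del: times_complex.sel)
    next
      case False
      then have "\<kappa> * Re (cnj e * ?z) \<le> 0" using \<kappa> by (simp add: mult_nonneg_nonpos)
      then show ?thesis using * by (simp add: escape_region_def escape_functional_def del: times_complex.sel)
    qed
    then have "\<bar>b\<bar> \<le> L" "\<bar>real N * a\<bar> \<le> L"
      using abs_Re_le_cmod[of ?z] abs_Im_le_cmod[of ?z] by auto
    moreover have "\<bar>a\<bar> \<le> \<bar>real N * a\<bar>"
      using N mult_right_mono[of 1 "real N" "\<bar>a\<bar>"] by (simp add: abs_mult)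
    ultimately show "(- L \<le> a \<and> a \<le> L) \<and> - L \<le> b \<and> b \<le> L" by linarith
  qed
  moreover have "bounded ({- L..L} \<times> {- L..L})"
    by (intro bounded_Times bounded_closed_interval)
  moreover have "closed (UNIV - (escape_region N L \<kappa> (- e) \<union> escape_region N L \<kappa> e))"
    by (intro closed_Diff open_Un open_escape_region closed_UNIV)
  ultimately show ?thesis
    using bounded_subset compact_eq_bounded_closed by blast
qed

text \<open>Orthogonally to \<open>e\<close> both functionals reduce to the norm, so the regions meet; and both functionals are homogeneous.\<close>

lemma emeasure_inter_escape_regions:
  assumes N: "N \<ge> 1" and L: "L \<ge> 0" and e: "norm e = 1"
  shows "emeasure lebesgue (escape_region N L \<kappa> (- e) \<inter> escape_region N L \<kappa> e) = \<infinity>"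
proof (rule emeasure_scaling_invariant_open)
  show "open (escape_region N L \<kappa> (- e) \<inter> escape_region N L \<kappa> e)"
    by (intro open_Int open_escape_region)
  define z where "z = of_real (L + 1) * (\<i> * e)"
  have "cnj e * z = of_real (L + 1) * \<i> * (e * cnj e)"
    by (simp add: z_def algebra_simps)
  then have "Re (cnj e * z) = 0" using e by (simp flip: complex_norm_square)
  moreover have "norm z = L + 1" using e L by (simp add: z_def norm_mult)
  moreover have "Complex (Re z) (real N * (Im z / real N)) = z" using N by simp
  ultimately have "(Im z / real N, Re z) \<in> escape_region N L \<kappa> (- e) \<inter> escape_region N L \<kappa> e"
    by (auto simp add: escape_region_def escape_functional_def simp del: times_complex.sel)
  then show "escape_region N L \<kappa> (- e) \<inter> escape_region N L \<kappa> e \<noteq> {}" by blast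
  have dbl: "2 *\<^sub>R w \<in> escape_region N L \<kappa> e'" if "w \<in> escape_region N L \<kappa> e'" for w e'
  proof -
    have "Complex (2 * b) (real N * (2 * a)) = 2 *\<^sub>R Complex b (real N * a)" for a b
      by (simp add: complex_eq_iff)
    moreover have "escape_functional \<kappa> e' (2 *\<^sub>R z) = 2 * escape_functional \<kappa> e' z" for z
      by (simp add: escape_functional_def algebra_simps)
    ultimately show ?thesis using that L by (auto simp: escape_region_def)
  qed
  show "2 *\<^sub>R w \<in> escape_region N L \<kappa> (- e) \<inter> escape_region N L \<kappa> e"
    if "w \<in> escape_region N L \<kappa> (- e) \<inter> escape_region N L \<kappa> e" for w
    using that dbl by blast
qed

section \<open>Bounds on the coupling and on the forcing\<close>

text \<open>The midpoint of the upper and lower limits serves as the centre \<open>c\<close>. Boundedness makes both limits finite, so that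
their real values in the definition of the oscillation are the true ones.\<close>

lemma oscillation_at_top_band:
  assumes bdd: "bounded (h ` {0..})" and \<epsilon>: "\<epsilon> > 0"
  obtains R c where "R \<ge> 0" "\<And>s. s \<ge> R \<Longrightarrow> \<bar>h s - c\<bar> \<le> oscillation_at_top h / 2 + \<epsilon>"
proof -
  obtain B where B: "\<And>s. s \<ge> 0 \<Longrightarrow> \<bar>h s\<bar> \<le> B"
    using bdd by (auto simp: bounded_iff)
  have ev: "\<forall>\<^sub>F s in at_top. \<bar>h s\<bar> \<le> B"
    using eventually_ge_at_top[of 0] by eventually_elim (rule B)
  let ?U = "Limsup at_top (\<lambda>s. ereal (h s))" and ?L = "Liminf at_top (\<lambda>s. ereal (h s))"
  have "?U \<le> ereal B" "ereal (- B) \<le> ?L"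
    using ev by (auto intro!: Limsup_bounded Liminf_bounded elim!: eventually_mono)
  moreover have "?L \<le> ?U" by (rule Liminf_le_Limsup) simp
  ultimately have fin: "\<bar>?U\<bar> \<noteq> \<infinity>" "\<bar>?L\<bar> \<noteq> \<infinity>"
    by auto
  then have U: "?U = ereal (upper_limit_at_top h)" and L: "?L = ereal (lower_limit_at_top h)"
    by (auto simp: upper_limit_at_top_def lower_limit_at_top_def ereal_real')
  have "\<forall>\<^sub>F s in at_top. ereal (h s) < ereal (upper_limit_at_top h + \<epsilon>)"
    using Limsup_le_iff[of at_top "\<lambda>s. ereal (h s)" ?U, THEN iffD1, rule_format, of "ereal (upper_limit_at_top h + \<epsilon>)"] \<epsilon>
    unfolding U by simp
  moreover have "\<forall>\<^sub>F s in at_top. ereal (lower_limit_at_top h - \<epsilon>) < ereal (h s)"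
    using le_Liminf_iff[of ?L at_top "\<lambda>s. ereal (h s)", THEN iffD1, rule_format, of "ereal (lower_limit_at_top h - \<epsilon>)"] \<epsilon>
    unfolding L by simp
  moreover note eventually_ge_at_top[of "0::real"]
  ultimately have "\<forall>\<^sub>F s in at_top. \<bar>h s - (upper_limit_at_top h + lower_limit_at_top h) / 2\<bar>
      \<le> oscillation_at_top h / 2 + \<epsilon>"
    by eventually_elim (auto simp: oscillation_at_top_def field_simps abs_le_iff)
  then obtain R where "\<And>s. s \<ge> R \<Longrightarrow> \<bar>h s - (upper_limit_at_top h + lower_limit_at_top h) / 2\<bar>
      \<le> oscillation_at_top h / 2 + \<epsilon>"
    by (auto simp: eventually_at_top_linorder)
  then show ?thesis by (intro that[of "max R 0"]) auto
qed

lemma oscillation_at_top_nonneg: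
  assumes "bounded (h ` {0..})"
  shows "oscillation_at_top h \<ge> 0"
proof (rule field_le_epsilon)
  fix \<epsilon> :: real assume "\<epsilon> > 0"
  then obtain R c where "R \<ge> 0" "\<And>s. s \<ge> R \<Longrightarrow> \<bar>h s - c\<bar> \<le> oscillation_at_top h / 2 + \<epsilon> / 2"
    using oscillation_at_top_band[OF assms, of "\<epsilon> / 2"] by auto
  from this(2)[of R] show "0 \<le> oscillation_at_top h + \<epsilon>" by linarith
qed

lemma bounded_periodic:
  assumes cont: "continuous_on UNIV (p :: real \<Rightarrow> real)" and per: "\<And>t. p (t + 2 * pi) = p t"
  shows "bounded (range p)"
proof -
  have "p t \<in> p ` {0..2 * pi}" for t
  proof -
    define k where "k = \<lfloor>t / (2 * pi)\<rfloor>"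
    have nat: "p (s + real m * (2 * pi)) = p s" for m s
    proof (induction m)
      case (Suc m)
      then show ?case using per[of "s + real m * (2 * pi)"] by (simp add: algebra_simps)
    qed simp
    have "p (t - of_int k * (2 * pi)) = p t"
    proof (cases "k \<ge> 0")
      case True
      then show ?thesis using nat[of "t - of_int k * (2 * pi)" "nat k"] by simp
    next
      case False
      then show ?thesis using nat[of t "nat (- k)"] by simp
    qed
    moreover have "t - of_int k * (2 * pi) \<in> {0..2 * pi}"
    proof -
      have "of_int k \<le> t / (2 * pi)" "t / (2 * pi) < of_int k + 1" unfolding k_def by linarith+
      then show ?thesis by (auto simp: field_simps)
    qed
    ultimately show ?thesis by (metis imageI)
  qed
  then have "range p \<subseteq> p ` {0..2 * pi}" by auto
  moreover have "compact (p ` {0..2 * pi})"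
    by (intro compact_continuous_image continuous_on_subset[OF cont]) auto
  ultimately show ?thesis using bounded_subset compact_imp_bounded by blast
qed

section \<open>Unbounded solutions of the radially coupled system\<close>

theorem theorem3p2:
  fixes n :: "'d::finite \<Rightarrow> real"
    and h :: "'d \<Rightarrow> real \<Rightarrow> real"
    and p :: "'d \<Rightarrow> real \<Rightarrow> real"
    and j :: 'd
  assumes n_pos: "\<And>i. n i > 0"
    and h_lipschitz: "\<And>i. local_lipschitz (UNIV :: real set) {0..} (\<lambda>_. h i)"
    and h_bounded: "\<And>i. bounded (h i ` {0..})"
    and p_continuous: "\<And>i. continuous_on UNIV (p i)"
    and p_periodic: "\<And>i t. p i (t + 2 * pi) = p i t"
    and n_j: "n j \<in> \<nat>"
    and h_j: "2 * oscillation_at_top (h j) <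
      cmod (integral {0..2 * pi} (\<lambda>t. complex_of_real (p j t) * exp (\<i> * complex_of_real (n j * t))))"
  shows "\<exists>C_minus C_plus :: (real \<times> real) set.
    open C_minus \<and> open C_plus \<and>
    compact (UNIV - (C_minus \<union> C_plus)) \<and>
    emeasure lebesgue (C_minus \<inter> C_plus) = \<infinity> \<and>
    (\<forall>x. solves_radial_system n h p x \<longrightarrow>
      ((x 0 $ j, deriv (\<lambda>s. x s $ j) 0) \<in> C_minus \<longrightarrow>
        filterlim (\<lambda>t. (x t $ j)\<^sup>2 + (deriv (\<lambda>s. x s $ j) t)\<^sup>2) at_top at_bot) \<and>
      ((x 0 $ j, deriv (\<lambda>s. x s $ j) 0) \<in> C_plus \<longrightarrow>
        filterlim (\<lambda>t. (x t $ j)\<^sup>2 + (deriv (\<lambda>s. x s $ j) t)\<^sup>2) at_top at_top))"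
proof -
  obtain N :: nat where N: "n j = real N" "N \<ge> 1"
    using n_j n_pos[of j] by (auto elim!: Nats_cases simp: Suc_le_eq)
  define P where "P = integral {0..2 * pi} (\<lambda>t. p j t *\<^sub>R cis (- (real N * t)))"
  have "cnj P = integral {0..2 * pi} (\<lambda>t. complex_of_real (p j t) * exp (\<i> * complex_of_real (n j * t)))"
    unfolding P_def integral_cnj
    by (simp add: scaleR_conv_of_real cis_cnj N(1)) (simp add: cis_conv_exp)
  then have "cmod (integral {0..2 * pi} (\<lambda>t. complex_of_real (p j t) * exp (\<i> * complex_of_real (n j * t)))) = norm P"
    by (metis complex_mod_cnj)
  then have gap: "2 * oscillation_at_top (h j) < norm P" using h_j by simp
  define D where "D = norm P - 2 * oscillation_at_top (h j)"
  have D: "D > 0" using gap by (simp add: D_def)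
  have osc: "oscillation_at_top (h j) \<ge> 0" by (rule oscillation_at_top_nonneg[OF h_bounded])
  then have P: "P \<noteq> 0" using gap by auto
  define e where "e = sgn P"
  have e: "norm e = 1" using P by (simp add: e_def norm_sgn)
  have eP: "Re (cnj e * P) = norm P"
  proof -
    have "cnj e * P = (P * cnj P) / norm P" by (simp add: e_def sgn_eq)
    also have "\<dots> = norm P" using P by (simp add: complex_norm_square[symmetric] power2_eq_square)
    finally show ?thesis by simp
  qed

  \<comment> \<open>The surplus \<open>D\<close> of the forcing is spent as follows: a quarter widens the band for \<open>h j\<close>
    (it enters four times), a quarter covers the times at which the \<open>j\<close>-th component is small, and half remains as gain.\<close>
  define \<rho> where "\<rho> = oscillation_at_top (h j) / 2 + D / 16"
  have \<rho>: "\<rho> \<ge> 0" using osc D by (simp add: \<rho>_def)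
  obtain R c where R: "R \<ge> 0" and band: "\<And>s. s \<ge> R \<Longrightarrow> \<bar>h j s - c\<bar> \<le> \<rho>"
    using oscillation_at_top_band[OF h_bounded, of "D / 16" j] D unfolding \<rho>_def by auto
  obtain Mh where Mh: "\<And>s. s \<ge> 0 \<Longrightarrow> \<bar>h j s\<bar> \<le> Mh"
    using h_bounded[of j] by (auto simp: bounded_iff)
  obtain Mp where Mp: "\<And>t. \<bar>p j t\<bar> \<le> Mp"
    using bounded_periodic[OF p_continuous p_periodic, of j] by (auto simp: bounded_iff)
  define M where "M = Mp + Mh"
  have M: "M \<ge> 0" using Mh[of 0] Mp[of 0] by (simp add: M_def)
  define B where "B = Mh + \<bar>c\<bar>"
  have B: "B \<ge> 0" using Mh[of 0] by (simp add: B_def)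
  obtain \<eta> b where \<eta>: "\<eta> > 0" and b: "continuous_on UNIV b" "\<And>s. b (s + 2 * pi) = b s"
    "\<And>s. b s \<ge> 0" "\<And>s. \<bar>sin s\<bar> \<le> \<eta> \<Longrightarrow> b s \<ge> 1"
    and int_b: "integral {0..2 * pi} b \<le> D / (4 * (B + 1))"
    using bump_near_sine_zeros[of "D / (4 * (B + 1))"] D B by auto
  have Bb: "B * integral {0..2 * pi} b \<le> D / 4"
  proof -
    have "B * integral {0..2 * pi} b \<le> B * (D / (4 * (B + 1)))"
      using int_b B by (rule mult_left_mono)
    also have "\<dots> \<le> (B + 1) * (D / (4 * (B + 1)))" using B D by (intro mult_right_mono) auto
    also have "\<dots> = D / 4" using B by (simp add: field_simps)
    finally show ?thesis .
  qed

  \<comment> \<open>Beyond \<open>R1\<close> a period starting from \<open>u\<close> has a gain; \<open>R2\<close> leaves room for the drift during one period,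
    because in backward time largeness is known only at the end of the period.\<close>
  define R1 where "R1 = (real N * R + 2 * pi * M) / \<eta>"
  define R2 where "R2 = R1 + 2 * pi * M"
  have R12: "R1 \<ge> 0" "R1 \<le> R2" using R M \<eta> by (simp_all add: R1_def R2_def)
  define \<kappa> where "\<kappa> = (2 * pi * M + 1) / (D / 2)"
  have \<kappa>: "\<kappa> \<ge> 0" "\<kappa> * (D / 2) \<ge> 2 * pi * M + 1" using M D by (simp_all add: \<kappa>_def)
  define L where "L = (1 + \<kappa>) * R2"
  have L: "L \<ge> 0" using \<kappa> R12 by (simp add: L_def)

  have dynamics: "((x 0 $ j, deriv (\<lambda>s. x s $ j) 0) \<in> escape_region N L \<kappa> (- e) \<longrightarrow>
        filterlim (\<lambda>t. (x t $ j)\<^sup>2 + (deriv (\<lambda>s. x s $ j) t)\<^sup>2) at_top at_bot) \<and>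
      ((x 0 $ j, deriv (\<lambda>s. x s $ j) 0) \<in> escape_region N L \<kappa> e \<longrightarrow>
        filterlim (\<lambda>t. (x t $ j)\<^sup>2 + (deriv (\<lambda>s. x s $ j) t)\<^sup>2) at_top at_top)"
    if x: "solves_radial_system n h p x" for x
  proof -
    define y where "y = (\<lambda>s. x s $ j)"
    define v where "v = deriv y"
    define g where "g t = h j (norm (x t))" for t
    define u where "u = rotating_state N y v"
    have y: "(y has_real_derivative v t) (at t)" for t
      using x unfolding solves_radial_system_def y_def v_def
      by (simp add: DERIV_deriv_iff_real_differentiable)
    have v: "(v has_real_derivative p j t - g t - (real N)\<^sup>2 * y t) (at t)" for t
    proof -
      have "(v has_real_derivative deriv v t) (at t)"
        using x unfolding solves_radial_system_def y_def v_def
        by (simp add: DERIV_deriv_iff_real_differentiable)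
      moreover have "deriv v t = p j t - g t - (real N)\<^sup>2 * y t"
      proof -
        have "deriv v t + (real N)\<^sup>2 * y t + g t = p j t"
          using x unfolding solves_radial_system_def y_def v_def g_def by (metis N(1))
        then show ?thesis by linarith
      qed
      ultimately show ?thesis by simp
    qed
    have force: "\<bar>p j t - g t\<bar> \<le> M" for t
      using Mp[of t] Mh[of "norm (x t)"] by (simp add: g_def M_def)
    have close: "\<bar>g t - c\<bar> \<le> \<rho>" if "\<bar>y t\<bar> \<ge> R" for t
      unfolding g_def using that component_le_norm_cart[of "x t" j] by (intro band) (simp add: y_def)
    have gB: "\<bar>g t - c\<bar> \<le> B" for t
      using Mh[of "norm (x t)"] by (simp add: g_def B_def)
    have lip: "norm (u t - u s) \<le> M * \<bar>t - s\<bar>" for s t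
      unfolding u_def by (rule rotating_state_lipschitz[OF y v force])
    have gain: "Re (cnj e * (u (T + 2 * pi) - u T)) \<ge> D / 2" if "norm (u T) \<ge> R1" for T
    proof -
      have "norm (u T) * \<eta> \<ge> real N * R + 2 * pi * M"
        using that \<eta> by (simp add: R1_def pos_divide_le_eq)
      then have "Re (cnj e * (u (T + 2 * pi) - u T)) \<ge>
          Re (cnj e * P) - 4 * \<rho> - B * integral {0..2 * pi} b"
        unfolding u_def P_def
        by (intro resonant_gain_over_period[OF N(2) y v p_continuous p_periodic force \<rho> _ gB b(1-3) _ _ e,
              where R = R and \<eta> = \<eta>] close b(4))
      moreover have "4 * \<rho> = 2 * oscillation_at_top (h j) + D / 4" by (simp add: \<rho>_def)
      ultimately show ?thesis using Bb eP D_def by linarith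
    qed
    have energy: "filterlim (\<lambda>t. (y t)\<^sup>2 + (v t)\<^sup>2) at_top F"
      if "filterlim (\<lambda>t. norm (u t)) at_top F" for F
    proof (rule filterlim_at_top_mono)
      show "LIM t F. (1 / (real N)\<^sup>2) * (norm (u t))\<^sup>2 :> at_top"
        using that N(2)
        by (intro filterlim_tendsto_pos_mult_at_top[OF tendsto_const] filterlim_pow_at_top) auto
      have "(norm (u t))\<^sup>2 \<le> (real N)\<^sup>2 * ((y t)\<^sup>2 + (v t)\<^sup>2)" for t
        using N(2) mult_right_mono[of 1 "(real N)\<^sup>2" "(v t)\<^sup>2"]
        by (simp add: u_def cmod_rotating_state power_mult_distrib distrib_left)
      then show "\<forall>\<^sub>F t in F. (1 / (real N)\<^sup>2) * (norm (u t))\<^sup>2 \<le> (y t)\<^sup>2 + (v t)\<^sup>2"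
        using N(2) by (intro always_eventually) (simp add: divide_le_eq mult.commute)
    qed
    have u0: "u 0 = Complex (v 0) (real N * y 0)" by (simp add: u_def rotating_state_def)
    have "filterlim (\<lambda>t. norm (u t)) at_top at_top" if "(y 0, v 0) \<in> escape_region N L \<kappa> e"
    proof (rule norm_at_top_if_escaping[OF lip _ e \<kappa>, where R = R2])
      show "D / 2 \<le> Re (cnj e * (u (2 * pi * real (Suc k)) - u (2 * pi * real k)))"
        if "norm (u (2 * pi * real k)) \<ge> R2" for k
        using gain[of "2 * pi * real k"] that R12 by (simp add: algebra_simps)
    qed (use that in \<open>simp add: escape_region_def u0 L_def\<close>)
  \<comment> \<open>Run backwards, a period with a gain along \<open>e\<close> becomes a period with a gain along \<open>- e\<close>.\<close>
    moreover have "filterlim (\<lambda>t. norm (u t)) at_top at_bot" if "(y 0, v 0) \<in> escape_region N L \<kappa> (- e)"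
      unfolding filterlim_at_bot_mirror
    proof (rule norm_at_top_if_escaping[OF _ _ _ \<kappa>, where R = R2 and e = "- e" and u = "\<lambda>t. u (- t)"])
      show "norm (u (- t) - u (- s)) \<le> M * \<bar>t - s\<bar>" for s t
        using lip[of "- t" "- s"] by (simp add: abs_minus_commute)
      show "D / 2 \<le> Re (cnj (- e) * (u (- (2 * pi * real (Suc k))) - u (- (2 * pi * real k))))"
        if large: "norm (u (- (2 * pi * real k))) \<ge> R2" for k
      proof -
        let ?S = "- (2 * pi * real (Suc k))"
        have fin: "?S + 2 * pi = - (2 * pi * real k)" by (simp add: algebra_simps)
        have "norm (u (?S + 2 * pi) - u ?S) \<le> 2 * pi * M"
          using lip[of "?S + 2 * pi" ?S] by (simp add: mult.commute)
        then have "norm (u ?S) \<ge> R1"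
          using large norm_triangle_ineq2[of "u (?S + 2 * pi)" "u ?S"] unfolding fin R2_def by linarith
        from gain[OF this] show ?thesis
          unfolding fin by (simp add: algebra_simps)
      qed
    qed (use that e in \<open>simp_all add: escape_region_def u0 L_def\<close>)
    ultimately show ?thesis
      using energy unfolding y_def v_def by blast
  qed
  show ?thesis
    by (intro exI[of _ "escape_region N L \<kappa> (- e)"] exI[of _ "escape_region N L \<kappa> e"] conjI allI impI
        open_escape_region compact_complement_escape_regions emeasure_inter_escape_regions N(2) \<kappa>(1) L e)
      (use dynamics in blast)+
qed

end
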